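(* The path $P_3$ is the only tree $T$ of order $n\ge 3$ satisfying $C_{tr}(T)=n-1$.
   Context: A set $S\subseteq V$ is a total restrained dominating set (TRD-set) of $G=(V,E)$ if every vertex of $V\setminus S$ is adjacent to at least one vertex of $S$ and to at least one other vertex of $V\setminus S$, and every vertex of $S$ is adjacent to at least one other vertex of $S$. Two disjoint sets $X,Y\subseteq V$ form a total restrained coalition if neither is a TRD-set but $X\cup Y$ is a TRD-set. A trc-partition of $G$ is a partition $\Phi$ of $V$ such that no member of $\Phi$ is a TRD-set and each member forms a total restrained coalition with some other member of $\Phi$. $C_{tr}(G)$ is the maximum cardinality of a trc-partition of $G$. *)

theory Defs
  imports
    "Graph_Theory.Digraph_Component"
    "Graph_Theory.Digraph_Isomorphism"
    "HOL-Library.Disjoint_Sets"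
begin

text \<open>
  Simple graphs are finite symmetric loop-free digraphs without parallel arcs, i.e. the locale
  \<^locale>\<open>graph\<close>; the edge \<open>uv\<close> is the pair of arcs \<open>(u, v)\<close>, \<open>(v, u)\<close>, so adjacency of
  \<open>u\<close> and \<open>v\<close> is \<open>u \<rightarrow>\<^bsub>G\<^esub> v\<close>.

  The library's \<open>tree\<close> does not fit this encoding: its \<open>forest\<close> forbids every directed
  cycle, including the closed walk \<open>u, v, u\<close> along an edge and back. The directed cycles of length
  at least three are exactly the traversals of the cycles of the undirected graph.
\<close>

definition tree_graph :: "('a, 'b) pre_digraph \<Rightarrow> bool" where
  "tree_graph G \<longleftrightarrow> graph G \<and> Digraph_Component.connected G \<and>
     \<not> (\<exists>p. pre_digraph.cycle G p \<and> 3 \<le> length p)"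

definition path_graph :: "nat \<Rightarrow> (nat, nat \<times> nat) pre_digraph" where
  "path_graph n = with_proj
     \<lparr> pverts = {0..<n},
       parcs = {(i, j). i < n \<and> j < n \<and> (j = Suc i \<or> i = Suc j)} \<rparr>"

definition trd_set :: "('a, 'b) pre_digraph \<Rightarrow> 'a set \<Rightarrow> bool" where
  "trd_set G S \<longleftrightarrow> S \<subseteq> verts G \<and>
     (\<forall>v \<in> verts G - S. (\<exists>u \<in> S. v \<rightarrow>\<^bsub>G\<^esub> u) \<and>
        (\<exists>w \<in> verts G - S. w \<noteq> v \<and> v \<rightarrow>\<^bsub>G\<^esub> w)) \<and>
     (\<forall>v \<in> S. \<exists>u \<in> S. u \<noteq> v \<and> v \<rightarrow>\<^bsub>G\<^esub> u)"

definition tr_coalition :: "('a, 'b) pre_digraph \<Rightarrow> 'a set \<Rightarrow> 'a set \<Rightarrow> bool" where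
  "tr_coalition G X Y \<longleftrightarrow> X \<subseteq> verts G \<and> Y \<subseteq> verts G \<and> X \<inter> Y = {} \<and>
     \<not> trd_set G X \<and> \<not> trd_set G Y \<and> trd_set G (X \<union> Y)"

definition trc_partition :: "('a, 'b) pre_digraph \<Rightarrow> 'a set set \<Rightarrow> bool" where
  "trc_partition G \<Phi> \<longleftrightarrow> partition_on (verts G) \<Phi> \<and>
     (\<forall>X \<in> \<Phi>. \<not> trd_set G X \<and> (\<exists>Y \<in> \<Phi>. Y \<noteq> X \<and> tr_coalition G X Y))"

text \<open>
  The maximum is meaningful only if a trc-partition exists. Every tree of order at least three has
  one: \<open>{{v}, V - {v}}\<close> for any leaf \<open>v\<close>.
\<close>

definition C_tr :: "('a, 'b) pre_digraph \<Rightarrow> nat" where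
  "C_tr G = Max {card \<Phi> | \<Phi>. trc_partition G \<Phi>}"

lemma graph_path_graph: "graph (path_graph n)"
proof -
  have "finite {(i, j). i < n \<and> j < n \<and> (j = Suc i \<or> i = Suc j)}"
    by (rule finite_subset[of _ "{0..<n} \<times> {0..<n}"]) auto
  then show ?thesis
    unfolding path_graph_def
    by unfold_locales (auto simp: symmetric_def sym_def arc_to_ends_def)
qed

lemma tree_graph_path_graph_3: "tree_graph (path_graph 3)"
proof -
  let ?G = "path_graph 3"
  interpret graph ?G by (rule graph_path_graph)
  have A: "(i, j) \<in> arcs_ends ?G \<longleftrightarrow> i < 3 \<and> j < 3 \<and> (j = Suc i \<or> i = Suc j)" for i j
    by (simp add: path_graph_def)
  have V: "verts ?G = {0, 1, 2}" by (auto simp: path_graph_def)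
  have E: "tail ?G = fst" "head ?G = snd" by (simp_all add: path_graph_def)
  have r: "0 \<rightarrow>\<^sup>*\<^bsub>?G\<^esub> 1" "1 \<rightarrow>\<^sup>*\<^bsub>?G\<^esub> 0" "1 \<rightarrow>\<^sup>*\<^bsub>?G\<^esub> 2" "2 \<rightarrow>\<^sup>*\<^bsub>?G\<^esub> 1"
    by (simp_all add: A)
  have q: "0 \<rightarrow>\<^sup>*\<^bsub>?G\<^esub> 2" "2 \<rightarrow>\<^sup>*\<^bsub>?G\<^esub> 0"
    by (rule reachable_trans[OF r(1) r(3)], rule reachable_trans[OF r(4) r(2)])
  have i: "0 \<rightarrow>\<^sup>*\<^bsub>?G\<^esub> 0" "1 \<rightarrow>\<^sup>*\<^bsub>?G\<^esub> 1" "2 \<rightarrow>\<^sup>*\<^bsub>?G\<^esub> 2"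
    by (rule reachable_refl, simp add: V)+
  have "\<forall>u \<in> verts ?G. \<forall>v \<in> verts ?G. u \<rightarrow>\<^sup>*\<^bsub>?G\<^esub> v"
    using q r i unfolding V by blast
  then have "\<forall>u \<in> verts ?G. \<forall>v \<in> verts ?G. u \<rightarrow>\<^sup>*\<^bsub>mk_symmetric ?G\<^esub> v"
    using reachable_mk_symmetricI by blast
  then have c: "Digraph_Component.connected ?G"
    by (simp add: Digraph_Component.connected_def strongly_connected_def V)
  have "False" if p: "cycle p" and l: "3 \<le> length p" for p
  proof -
    from p obtain u where w: "awalk u p u" and d: "distinct (tl (awalk_verts u p))"
      by (auto simp: cycle_def)
    have "set (awalk_verts u p) \<subseteq> verts ?G"
      using w by (rule awalkE')
    then have "set (tl (awalk_verts u p)) \<subseteq> {0, 1, 2}"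
      unfolding V by (cases "awalk_verts u p") simp_all
    then have "card (set (tl (awalk_verts u p))) \<le> card {0, 1, 2 :: nat}"
      by (intro card_mono) auto
    moreover have "card (set (tl (awalk_verts u p))) = length p"
      using d by (simp add: distinct_card length_awalk_verts)
    ultimately have "length p = 3"
      using l by simp
    then obtain e f g where pp: "p = [e, f, g]"
      by (auto simp: numeral_3_eq_3 length_Suc_conv)
    have "fst e = u" "snd e = fst f" "snd f = fst g" "snd g = u"
      using w unfolding pp by (auto simp: awalk_def cas.simps E)
    moreover have "odd (fst x + snd x)" if "x \<in> {e, f, g}" for x
    proof -
      have "x \<in> arcs ?G" using that w unfolding pp by (auto simp: awalk_def)
      then show ?thesis by (auto simp: path_graph_def)
    qed
    then have "odd (fst e + snd e)" "odd (fst f + snd f)" "odd (fst g + snd g)"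
      by blast+
    ultimately show False by auto
  qed
  with c show ?thesis unfolding tree_graph_def using graph_path_graph by blast
qed

end

theory Submission
  imports Defs
begin

text \<open>
  The ends of a longest path of a tree of order at least three are two leaves \<open>a\<close>, \<open>c\<close>, and \<open>a\<close> has
  a neighbour \<open>b\<close> other than \<open>c\<close>. Every TRD-set contains \<open>a\<close>, \<open>b\<close> and \<open>c\<close>: leaves cannot lie outside
  of it, and a leaf in it needs its neighbour. If a trc-partition has at least three members, some
  member contains none of these vertices, so its partner contains all three, and hence
  there are at most \<open>n - 2\<close> members. Therefore \<open>C\<^sub>t\<^sub>r(T) = n - 1\<close> forces \<open>n - 1 \<le> 2\<close>.
\<close>

section \<open>Trees as symmetric digraphs\<close>

locale tree_digraph = graph G for G :: "('a, 'b) pre_digraph" (structure) +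
  assumes conn: "Digraph_Component.connected G"
    and acyc: "cycle p \<Longrightarrow> length p < 3"
    and order: "3 \<le> card (verts G)"

lemma tree_digraph_iff:
  "tree_digraph G \<longleftrightarrow> tree_graph G \<and> 3 \<le> card (verts G)"
  unfolding tree_graph_def tree_digraph_def tree_digraph_axioms_def by (auto simp: not_le)

context tree_digraph
begin

section \<open>Longest paths and leaves\<close>

definition longest :: "'a \<Rightarrow> 'b awalk \<Rightarrow> 'a \<Rightarrow> bool" where
  "longest u p v \<longleftrightarrow> apath u p v \<and> (\<forall>u' p' v'. apath u' p' v' \<longrightarrow> length p' \<le> length p)"

text \<open>Simple paths have at most as many arcs as there are vertices, and the empty path at any
  vertex is one, so the maximum is attained.\<close>

lemma longest_exists: "\<exists>u p v. longest u p v"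
proof -
  obtain x where "x \<in> verts G" using order by fastforce
  then have "\<exists>n. \<exists>u p v. apath u p v \<and> length p = n" using apath_Nil_iff by blast
  moreover have "\<forall>n. (\<exists>u p v. apath u p v \<and> length p = n) \<longrightarrow> n \<le> card (verts G)"
    using length_apath by blast
  ultimately obtain n where "\<exists>u p v. apath u p v \<and> length p = n"
    and "\<forall>m. (\<exists>u p v. apath u p v \<and> length p = m) \<longrightarrow> m \<le> n"
    using Nat.ex_has_greatest_nat[of "\<lambda>n. \<exists>u p v. apath u p v \<and> length p = n" _ "card (verts G)"]
    by metis
  then show ?thesis unfolding longest_def by blast
qed

lemma adj_irrefl: "u \<rightarrow>\<^bsub>G\<^esub> v \<Longrightarrow> u \<noteq> v"
  using no_loops by fastforce

text \<open>By maximality \<open>w\<close> lies on the path, since otherwise the arc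
  \<open>f\<close> from \<open>w\<close> to \<open>u\<close> could be prepended. Then
  \<open>f\<close> and the initial piece \<open>q\<close> up to \<open>w\<close> close a cycle. As
  cycles have length below three, \<open>q\<close> is the single arc \<open>e\<close>.\<close>

lemma longest_start:
  assumes L: "longest u (e # p) v" and "u \<rightarrow>\<^bsub>G\<^esub> w"
  shows "w = head G e"
proof -
  from assms(2) have "w \<rightarrow>\<^bsub>G\<^esub> u" using arcs_ends_symmetric[OF sym_arcs] by blast
  then obtain f where f: "f \<in> arcs G" "tail G f = w" "head G f = u" by auto
  have P: "apath u (e # p) v" using L by (simp add: longest_def)
  have "w \<in> set (awalk_verts u (e # p))"
  proof (rule ccontr)
    assume "\<not> ?thesis"
    then have "apath w (f # e # p) v" using P f by (subst apath_Cons_iff) auto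
    then show False using L unfolding longest_def by fastforce
  qed
  then obtain q r where qr: "e # p = q @ r" "awalk u q w" "awalk w r v"
    using awalk_decomp P unfolding apath_def by metis
  have "distinct (awalk_verts u q)"
    using P qr unfolding apath_def qr(1) by (auto simp: awalk_verts_append)
  then have "cycle (f # q)"
    using qr f unfolding cycle_def by (auto simp: awalk_Cons_iff intro!: exI[of _ w])
  then have l: "length q < 2" using acyc by fastforce
  have "q \<noteq> []" using qr(2) adj_irrefl[OF assms(2)] by (auto simp: awalk_Nil_iff)
  with l have "q = [e]" using qr(1) by (cases q) auto
  then show ?thesis using qr(2) by (auto simp: awalk_simps)
qed

text \<open>Mirror image of \<open>longest_start\<close>: the arc \<open>f\<close> from
  \<open>v\<close> to \<open>w\<close> closes the final piece \<open>r\<close> of the path to a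
  cycle.\<close>

lemma longest_end:
  assumes L: "longest u (p @ [e]) v" and "v \<rightarrow>\<^bsub>G\<^esub> w"
  shows "w = tail G e"
proof -
  from assms(2) obtain f where f: "f \<in> arcs G" "tail G f = v" "head G f = w" by auto
  have P: "apath u (p @ [e]) v" using L by (simp add: longest_def)
  then have W: "awalk u (p @ [e]) v" and last: "awlast u (p @ [e]) = v" by (auto simp: apath_def)
  have "w \<in> set (awalk_verts u (p @ [e]))"
  proof (rule ccontr)
    assume "\<not> ?thesis"
    moreover have "apath v [f] w" using f adj_irrefl[OF assms(2)] by (auto simp: apath_simps)
    ultimately have "apath u ((p @ [e]) @ [f]) w"
      using P last f by (subst apath_append_iff) simp
    then show False using L unfolding longest_def by fastforce
  qed
  then obtain q r where qr: "p @ [e] = q @ r" "awalk u q w" "awalk w r v"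
    using awalk_decomp W by metis
  have D: "distinct (awalk_verts w r)"
    using P qr(2,3) unfolding apath_def qr(1) by (auto simp: awalk_verts_append2)
  \<comment> \<open>\<open>cycle\<close> requires distinctness only of the tail of the vertex list:
    \<open>w\<close> is dropped at the front and reappears once at the end.\<close>
  have "awalk_verts w (r @ [f]) = awalk_verts w r @ [w]"
    using qr(3) f by (subst awalk_verts_append[where v = w]) (auto simp: awalk_simps)
  moreover have "w \<notin> set (tl (awalk_verts w r))"
    using D qr(3) by (cases "awalk_verts w r") auto
  ultimately have "cycle (r @ [f])"
    using D qr(3) f unfolding cycle_def
    by (auto simp: awalk_simps distinct_tl intro!: exI[of _ w])
  then have l: "length r < 2" using acyc by fastforce
  have "r \<noteq> []" using qr(3) adj_irrefl[OF assms(2)] by (auto simp: awalk_Nil_iff)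
  with l have "r = [e]" using qr(1) by (cases r rule: rev_cases) auto
  then show ?thesis using qr(3) by (auto simp: awalk_simps)
qed

text \<open>Connectedness as an induction principle; it bounds the order by the size of any small
  set closed under adjacency.\<close>

lemma closed_imp_verts:
  assumes "x \<in> S" "x \<in> verts G" and cl: "\<And>y z. y \<in> S \<Longrightarrow> y \<rightarrow>\<^bsub>G\<^esub> z \<Longrightarrow> z \<in> S"
  shows "verts G \<subseteq> S"
proof
  fix y assume "y \<in> verts G"
  then have "x \<rightarrow>\<^sup>* y"
    using symmetric_connected_imp_strongly_connected[OF sym_arcs conn] assms(2) by blast
  then show "y \<in> S"
    by (induction rule: reachable_induct) (use assms(1) cl in auto)
qed

lemma adj_exists:
  assumes "x \<in> verts G"
  shows "\<exists>y. x \<rightarrow>\<^bsub>G\<^esub> y"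
proof (rule ccontr)
  assume "\<not> ?thesis"
  then have "verts G \<subseteq> {x}" using assms by (intro closed_imp_verts[of x]) auto
  then have "card (verts G) \<le> 1" using card_mono[of "{x}"] by simp
  then show False using order by simp
qed

text \<open>\<open>a\<close> and \<open>c\<close> are the ends of a longest path and
  \<open>b\<close> is its second vertex. That \<open>b\<close> and \<open>c\<close> differ needs a
  path with at least two arcs.\<close>

lemma leaves_exist:
  obtains a b c d where "a \<in> verts G" "b \<in> verts G" "c \<in> verts G" "distinct [a, b, c]"
    "\<And>w. a \<rightarrow>\<^bsub>G\<^esub> w \<longleftrightarrow> w = b" "\<And>w. c \<rightarrow>\<^bsub>G\<^esub> w \<longleftrightarrow> w = d"
proof -
  obtain u p v where L: "longest u p v" using longest_exists by blast
  then have P: "apath u p v" by (simp add: longest_def)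
  then have uv: "u \<in> verts G" "v \<in> verts G" by (auto simp: apath_def)
  have "p \<noteq> []"
  proof
    assume p: "p = []"
    obtain w where "u \<rightarrow>\<^bsub>G\<^esub> w" using adj_exists uv by blast
    then obtain f where "f \<in> arcs G" "tail G f = u" "head G f = w" by auto
    then have "apath u [f] w" using adj_irrefl[OF \<open>u \<rightarrow>\<^bsub>G\<^esub> w\<close>] by (auto simp: apath_simps)
    then show False using L p unfolding longest_def by fastforce
  qed
  then obtain e p1 where p1: "p = e # p1" by (cases p) auto
  obtain g p2 where p2: "p = p2 @ [g]" using \<open>p \<noteq> []\<close> by (cases p rule: rev_cases) auto
  have nu: "u \<rightarrow>\<^bsub>G\<^esub> w \<longleftrightarrow> w = head G e" for w
    using longest_start L adj_exists[OF uv(1)] unfolding p1 by metis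
  have nv: "v \<rightarrow>\<^bsub>G\<^esub> w \<longleftrightarrow> w = tail G g" for w
    using longest_end L adj_exists[OF uv(2)] unfolding p2 by metis
  \<comment> \<open>With a single arc, \<open>u\<close> and \<open>v\<close> would be each other's
    only neighbours, and connectedness would leave no third vertex.\<close>
  have "p1 \<noteq> []"
  proof
    assume "p1 = []"
    then have "g = e" "tail G e = u" "head G e = v"
      using p1 p2 P by (auto simp: apath_simps)
    then have "verts G \<subseteq> {u, v}"
      using uv nu nv by (intro closed_imp_verts[of u]) auto
    then have "card (verts G) \<le> card {u, v}" by (intro card_mono) auto
    also have "\<dots> \<le> 2" by (simp add: card_insert_if)
    finally show False using order by simp
  qed
  have Q: "apath (head G e) p1 v" "u \<notin> set (awalk_verts (head G e) p1)"
    using P unfolding p1 by (auto simp: apath_simps)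
  have "head G e \<noteq> v" using apath_nonempty_ends Q(1) \<open>p1 \<noteq> []\<close> by blast
  moreover have "u \<noteq> head G e" using nu adj_irrefl by blast
  moreover have "u \<noteq> v" using apath_nonempty_ends P \<open>p \<noteq> []\<close> by blast
  moreover have "head G e \<in> verts G" using Q by (auto simp: apath_def)
  ultimately show ?thesis using that[of u "head G e" v] uv nu nv by simp
qed

section \<open>TRD-sets and trc-partitions\<close>

text \<open>Outside \<open>S\<close> the vertex \<open>a\<close> would need one neighbour in
  \<open>S\<close> and one outside, but it has only \<open>b\<close>.\<close>

lemma leaf_in_trd_set:
  assumes "trd_set G S" "a \<in> verts G" "\<And>w. a \<rightarrow>\<^bsub>G\<^esub> w \<longleftrightarrow> w = b"
  shows "a \<in> S" "b \<in> S"
  using assms unfolding trd_set_def by (metis Diff_iff)+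

lemma trd_set_verts: "trd_set G (verts G)"
  unfolding trd_set_def using adj_exists adj_irrefl by (metis Diff_cancel adj_in_verts(2) empty_iff
      subset_refl)

text \<open>The last clause is kept for identifying trees of order three with
  \<open>path_graph 3\<close>.\<close>

lemma trd_core_exists:
  obtains a b c where "a \<in> verts G" "b \<in> verts G" "c \<in> verts G" "distinct [a, b, c]"
    "\<And>S. trd_set G S \<Longrightarrow> {a, b, c} \<subseteq> S"
    "\<And>w. a \<rightarrow>\<^bsub>G\<^esub> w \<longleftrightarrow> w = b"
proof -
  obtain a b c d where "a \<in> verts G" "b \<in> verts G" "c \<in> verts G" "distinct [a, b, c]"
    "\<And>w. a \<rightarrow>\<^bsub>G\<^esub> w \<longleftrightarrow> w = b" "\<And>w. c \<rightarrow>\<^bsub>G\<^esub> w \<longleftrightarrow> w = d" using leaves_exist by blast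
  then show ?thesis using leaf_in_trd_set by (intro that[of a b c]) blast+
qed

text \<open>A leaf and its complement both miss part of the core, while their union is everything.
  This makes the maximum in \<open>C_tr\<close> range over a nonempty set.\<close>

lemma trc_partition_exists: "\<exists>\<Phi>. trc_partition G \<Phi> \<and> card \<Phi> = 2"
proof -
  obtain a b c where abc: "a \<in> verts G" "b \<in> verts G" "c \<in> verts G" "distinct [a, b, c]"
    and core: "\<And>S. trd_set G S \<Longrightarrow> {a, b, c} \<subseteq> S" using trd_core_exists by metis
  let ?X = "{a}" and ?Y = "verts G - {a}"
  have "\<not> trd_set G ?X" "\<not> trd_set G ?Y" using core abc by auto
  moreover have "?X \<union> ?Y = verts G" using abc by auto
  ultimately have "tr_coalition G ?X ?Y" "tr_coalition G ?Y ?X"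
    using trd_set_verts abc unfolding tr_coalition_def by (auto simp: Un_commute)
  moreover have "partition_on (verts G) {?X, ?Y}"
    using abc by (auto simp: partition_on_def disjoint_def)
  moreover have "?X \<noteq> ?Y" by auto
  ultimately have "trc_partition G {?X, ?Y}"
    using \<open>\<not> trd_set G ?X\<close> \<open>\<not> trd_set G ?Y\<close> unfolding trc_partition_def by auto
  then show ?thesis using \<open>?X \<noteq> ?Y\<close> by (metis card_2_iff)
qed

lemma card_trc_partition:
  assumes "trc_partition G \<Phi>"
  shows "card \<Phi> \<le> max 2 (card (verts G) - 2)"
proof (rule ccontr)
  assume N: "\<not> ?thesis"
  obtain a b c where abc: "a \<in> verts G" "b \<in> verts G" "c \<in> verts G" "distinct [a, b, c]"
    and core: "\<And>S. trd_set G S \<Longrightarrow> {a, b, c} \<subseteq> S" using trd_core_exists by metis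
  have part: "partition_on (verts G) \<Phi>"
    using assms by (simp add: trc_partition_def)
  have partner: "\<exists>Y \<in> \<Phi>. Y \<noteq> X \<and> {a, b, c} \<subseteq> X \<union> Y" if "X \<in> \<Phi>" for X
    using assms that core unfolding trc_partition_def tr_coalition_def by meson
  have fin: "finite \<Phi>" using finite_elements[OF finite_verts part] .
  have disj: "X = Y" if "X \<in> \<Phi>" "Y \<in> \<Phi>" "x \<in> X" "x \<in> Y" for X Y x
    using partition_onD2[OF part] that unfolding disjoint_def by blast
  obtain A where A: "A \<in> \<Phi>" "a \<in> A" using partition_onD1[OF part] abc by blast
  obtain B where B: "B \<in> \<Phi>" "B \<noteq> A" "{a, b, c} \<subseteq> A \<union> B" using partner A by blast
  have "\<not> \<Phi> \<subseteq> {A, B}"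
    using N card_mono[of "{A, B}" \<Phi>] B(2) by auto
  then obtain X where X: "X \<in> \<Phi>" "X \<noteq> A" "X \<noteq> B" by blast
  \<comment> \<open>The core is already covered by \<open>A\<close> and \<open>B\<close>, from which
    \<open>X\<close> is disjoint.\<close>
  then have "X \<inter> {a, b, c} = {}" using disj[of X A] disj[of X B] A B by blast
  then obtain Y where Y: "Y \<in> \<Phi>" "{a, b, c} \<subseteq> Y" using partner[OF X(1)] by blast
  have "card {a, b, c} \<le> card Y"
    using Y finite_verts partition_onD1[OF part] by (intro card_mono) (auto intro: finite_subset)
  then have "3 \<le> card Y" using abc by simp
  \<comment> \<open>Every other member contributes at least one vertex and \<open>Y\<close> at least
    three, so the order is at least \<open>card \<Phi> + 2\<close>.\<close>
  moreover have "card (\<Phi> - {Y}) \<le> (\<Sum>Z\<in>\<Phi> - {Y}. card Z)"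
  proof -
    have "1 \<le> card Z" if "Z \<in> \<Phi>" for Z
      using that partition_onD1[OF part] partition_onD3[OF part] finite_verts
      by (metis One_nat_def Suc_leI Sup_upper card_gt_0_iff finite_subset)
    then have "(\<Sum>Z\<in>\<Phi> - {Y}. 1) \<le> (\<Sum>Z\<in>\<Phi> - {Y}. card Z)" by (intro sum_mono) auto
    then show ?thesis by simp
  qed
  moreover have "card (verts G) = (\<Sum>Z\<in>\<Phi>. card Z)"
    using product_partition[OF part] finite_verts partition_onD1[OF part]
    by (metis Sup_upper finite_subset)
  moreover have "(\<Sum>Z\<in>\<Phi>. card Z) = card Y + (\<Sum>Z\<in>\<Phi> - {Y}. card Z)"
    using fin Y by (simp add: sum.remove)
  moreover have "card (\<Phi> - {Y}) = card \<Phi> - 1" using Y fin by simp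
  ultimately show False using N by linarith
qed

text \<open>\<open>C_tr G\<close> lies between 2 and \<open>max 2 (card (verts G) - 2)\<close>. The
  second argument of \<open>max\<close> is too small for equality, so the order minus one must be 2;
  at order three both bounds are 2.\<close>

lemma C_tr_eq_order_minus_1_iff: "C_tr G = card (verts G) - 1 \<longleftrightarrow> card (verts G) = 3"
proof -
  let ?C = "{card \<Phi> | \<Phi>. trc_partition G \<Phi>}"
  have bound: "m \<le> max 2 (card (verts G) - 2)" if "m \<in> ?C" for m
    using that card_trc_partition by blast
  then have fin: "finite ?C" using finite_nat_set_iff_bounded_le by blast
  have two: "2 \<in> ?C" using trc_partition_exists by (metis (mono_tags, lifting) mem_Collect_eq)
  have "C_tr G \<le> max 2 (card (verts G) - 2)" "2 \<le> C_tr G"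
    unfolding C_tr_def using bound Max_in[OF fin] Max_ge[OF fin two] two by blast+
  then show ?thesis using order by auto
qed

section \<open>Recognising the path on three vertices\<close>

lemma digraph_iso_path_graph_3_iff: "digraph_iso G (path_graph 3) \<longleftrightarrow> card (verts G) = 3"
proof
  assume "digraph_iso G (path_graph 3)"
  then obtain h where h: "digraph_isomorphism h" "path_graph 3 = app_iso h G"
    unfolding digraph_iso_def by blast
  have "card (iso_verts h ` verts G) = card (verts G)"
    using h(1) by (intro card_image digraph_isomorphism_inj_on_verts)
  moreover have "iso_verts h ` verts G = {0..<3}"
    unfolding verts_app_iso[symmetric] h(2)[symmetric] by (simp add: path_graph_def)
  ultimately show "card (verts G) = 3" by simp
next
  assume n: "card (verts G) = 3"
  obtain a b c where abc: "a \<in> verts G" "b \<in> verts G" "c \<in> verts G" and d: "distinct [a, b, c]"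
    and na: "\<And>w. a \<rightarrow>\<^bsub>G\<^esub> w \<longleftrightarrow> w = b"
    using trd_core_exists by metis
  have "{a, b, c} = verts G" using abc d n by (intro card_subset_eq) auto
  then have V: "verts G = {a, b, c}" ..
  have sym: "x \<rightarrow>\<^bsub>G\<^esub> y \<longleftrightarrow> y \<rightarrow>\<^bsub>G\<^esub> x" for x y
    using arcs_ends_symmetric[OF sym_arcs] by blast
  obtain w where w: "c \<rightarrow>\<^bsub>G\<^esub> w" using adj_exists abc by blast
  \<comment> \<open>\<open>w\<close> is not \<open>c\<close>, as there are no loops, and not
    \<open>a\<close>, whose only neighbour is \<open>b\<close>.\<close>
  then have "w = b" using V na sym adj_irrefl d adj_in_verts
    by (metis distinct_length_2_or_more insert_iff empty_iff)
  with w have cb: "c \<rightarrow>\<^bsub>G\<^esub> b" by simp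
  \<comment> \<open>Numbers the vertices along the path \<open>a\<close>, \<open>b\<close>,
    \<open>c\<close>; the default value 2 is that of \<open>c\<close>.\<close>
  define f where "f x = (if x = a then 0 else if x = b then 1 else 2 :: nat)" for x
  have adj: "x \<rightarrow>\<^bsub>G\<^esub> y \<longleftrightarrow> f x < 3 \<and> f y < 3 \<and> (f y = Suc (f x) \<or> f x = Suc (f y))"
    if "x \<in> verts G" "y \<in> verts G" for x y
  proof -
    have "\<not> z \<rightarrow>\<^bsub>G\<^esub> z" for z using adj_irrefl by blast
    moreover have "a \<rightarrow>\<^bsub>G\<^esub> b" "\<not> a \<rightarrow>\<^bsub>G\<^esub> c" using na d by auto
    moreover from this cb have "b \<rightarrow>\<^bsub>G\<^esub> a" "b \<rightarrow>\<^bsub>G\<^esub> c" "\<not> c \<rightarrow>\<^bsub>G\<^esub> a" using sym by blast+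
    moreover have "f a = 0" "f b = 1" "f c = 2" using d by (auto simp: f_def)
    ultimately show ?thesis using that cb unfolding V by (elim insertE emptyE) simp_all
  qed
  have inj: "inj_on f (verts G)" unfolding V f_def using d by (auto simp: inj_on_def)
  have fV: "f ` verts G = {0..<3}" unfolding V f_def using d by auto
  \<comment> \<open>Arcs of \<open>path_graph\<close> are pairs of endpoints, so each arc goes to
    the pair of its numbered ends; the absence of parallel arcs makes this injective.\<close>
  define h where "h = \<lparr> iso_verts = f, iso_arcs = \<lambda>e. (f (tail G e), f (head G e)),
    iso_head = snd, iso_tail = fst \<rparr>"
  have "digraph_isomorphism h"
    unfolding digraph_isomorphism_def h_def
    using inj wf_digraph
    by (auto intro!: inj_onI no_multi_arcs simp: arc_to_ends_def inj_on_eq_iff[OF inj])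
  moreover have "(\<lambda>e. (f (tail G e), f (head G e))) ` arcs G =
      {(i, j). i < 3 \<and> j < 3 \<and> (j = Suc i \<or> i = Suc j)}" (is "?L = ?R")
  proof
    show "?L \<subseteq> ?R" using adj in_arcs_imp_in_arcs_ends by fastforce
    show "?R \<subseteq> ?L"
    proof clarify
      fix i j :: nat assume ij: "i < 3" "j < 3" "j = Suc i \<or> i = Suc j"
      then have "i \<in> f ` verts G" "j \<in> f ` verts G" unfolding fV by auto
      then obtain x y where xy: "x \<in> verts G" "y \<in> verts G" "i = f x" "j = f y" by blast
      have "x \<rightarrow>\<^bsub>G\<^esub> y" using adj[OF xy(1,2)] ij unfolding xy(3,4) by simp
      then obtain e where "e \<in> arcs G" "tail G e = x" "head G e = y" by auto
      then show "(i, j) \<in> ?L" unfolding xy(3,4) by blast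
    qed
  qed
  then have "path_graph 3 = app_iso h G"
    using fV unfolding path_graph_def app_iso_def h_def with_proj_def by simp
  ultimately show "digraph_iso G (path_graph 3)" unfolding digraph_iso_def by blast
qed

end

theorem theorem4p4:
  fixes T :: "('a, 'b) pre_digraph"
  assumes "tree_graph T" and "3 \<le> card (verts T)"
  shows "C_tr T = card (verts T) - 1 \<longleftrightarrow> digraph_iso T (path_graph 3)"
proof -
  interpret tree_digraph T using assms by (simp add: tree_digraph_iff)
  show ?thesis using C_tr_eq_order_minus_1_iff digraph_iso_path_graph_3_iff by simp
qed

end
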